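(* Let $\mathbb{V}$ be a real Hilbert space and let $\mathbb{J}$ be a finite set. Let $\{V_j\}_{j\in\mathbb{J}}$ be a family of subsets of $\mathbb{V}$, not all empty, that are all symmetric and weakly bounded, that is, $$-V_j=V_j\quad\text{and}\quad \mathrm{bar}\,V_j=\mathbb{V},\qquad\forall j\in\mathbb{J},$$ and that jointly satisfy the full sum condition $$\sum_{j\in\mathbb{J}}\mathrm{span}\,V_j=\mathbb{V}.$$ Then there is a (unique) norm $|||\cdot|||$ on $\mathbb{V}$ with unit ball $\overline{\mathrm{co}}\big(\bigcup_{j\in\mathbb{J}}V_j\big)$. Moreover, the norm $|||\cdot|||$ admits a dual norm $|||\cdot|||_\star$ with unit ball $\big(\bigcup_{j\in\mathbb{J}}V_j\big)^{\odot}$. The norm $|||\cdot|||$ and the dual norm $|||\cdot|||_\star$ are given by $$|||\cdot|||=\sigma_{\left(\bigcup_{j\in\mathbb{J}}V_j\right)^{\odot}}\quad\text{and}\quad|||\cdot|||_\star=\sigma_{\overline{\mathrm{co}}\left(\bigcup_{j\in\mathbb{J}}V_j\right)},$$ and their respective unit balls are $$B_{|||\cdot|||}=\overline{\mathrm{co}}\Big(\bigcup_{j\in\mathbb{J}}V_j\Big)\quad\text{and}\quad B_{|||\cdot|||_\star}=\Big(\bigcup_{j\in\mathbb{J}}V_j\Big)^{\odot}.$$ The topologies defined by the norm $|||\cdot|||$ and by the dual norm $|||\cdot|||_\star$ are both weaker (contain fewer open sets, in the non-strict sense) than the Hilbertian topology.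
   Context: For $V\subset\mathbb{V}$: support function $\sigma_V(v')=\sup_{v\in V}\langle v,v'\rangle$; barrier cone $\mathrm{bar}\,V=\{v'\in\mathbb{V}:\sigma_V(v')<+\infty\}$; polar set $V^{\odot}=\{v'\in\mathbb{V}:\langle v,v'\rangle\le1\ \forall v\in V\}$; $\overline{\mathrm{co}}(V)$ is the closed convex hull and $\mathrm{span}\,V$ the linear span. The unit ball of a norm $N$ is $B_N=\{v:N(v)\le1\}$. A norm $|||\cdot|||$ on $\mathbb{V}$ admits a dual norm if the support function $\sigma_{B_{|||\cdot|||}}$ of its unit ball is a norm on $\mathbb{V}$; this norm is then the dual norm $|||\cdot|||_\star$. The Hilbertian topology is the one of the norm $\sqrt{\langle\cdot,\cdot\rangle}$. *)

theory Defs
  imports "HOL-Analysis.Analysis"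
begin

text \<open>
  Real Hilbert spaces are the types of sort \<open>{real_inner, complete_space}\<close>; \<open>open\<close> and
  \<open>closure\<close> refer to the topology of \<open>norm v = sqrt (v \<bullet> v)\<close>.
\<close>

definition is_norm :: "('a::real_vector \<Rightarrow> real) \<Rightarrow> bool" where
  "is_norm N \<longleftrightarrow>
     (\<forall>v. 0 \<le> N v) \<and> (\<forall>v. N v = 0 \<longleftrightarrow> v = 0) \<and>
     (\<forall>c v. N (c *\<^sub>R v) = \<bar>c\<bar> * N v) \<and> (\<forall>v w. N (v + w) \<le> N v + N w)"

definition unit_ball :: "('a \<Rightarrow> real) \<Rightarrow> 'a set" where
  "unit_ball N = {v. N v \<le> 1}"

text \<open>Extended-real valued: \<open>-\<infinity>\<close> on the empty set, \<open>\<infinity>\<close> in unbounded directions.\<close>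

definition support_function :: "'a::real_inner set \<Rightarrow> 'a \<Rightarrow> ereal" where
  "support_function V v' = (SUP v\<in>V. ereal (v \<bullet> v'))"

definition barrier_cone :: "'a::real_inner set \<Rightarrow> 'a set" where
  "barrier_cone V = {v'. support_function V v' < \<infinity>}"

definition polar_set :: "'a::real_inner set \<Rightarrow> 'a set" where
  "polar_set V = {v'. \<forall>v\<in>V. v \<bullet> v' \<le> 1}"

definition closed_convex_hull :: "'a::real_normed_vector set \<Rightarrow> 'a set" where
  "closed_convex_hull V = closure (convex hull V)"

lemma closed_convex_hull_eq_hull:
  "closed_convex_hull V = (\<lambda>C. closed C \<and> convex C) hull V"
proof (rule hull_unique[symmetric])
  show "V \<subseteq> closed_convex_hull V"
    unfolding closed_convex_hull_def by (rule order_trans[OF hull_subset closure_subset])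
  show "closed (closed_convex_hull V) \<and> convex (closed_convex_hull V)"
    by (simp add: closed_convex_hull_def convex_closure)
  show "closed_convex_hull V \<subseteq> C" if "V \<subseteq> C" "closed C \<and> convex C" for C
    using that by (simp add: closed_convex_hull_def closure_minimal hull_minimal)
qed

definition admits_dual_norm :: "('a::real_inner \<Rightarrow> real) \<Rightarrow> bool" where
  "admits_dual_norm N \<longleftrightarrow>
     (\<exists>M. is_norm M \<and> (\<forall>v'. ereal (M v') = support_function (unit_ball N) v'))"

text \<open>Meaningful only if \<open>admits_dual_norm N\<close>, in which case the support function is finite.\<close>

definition dual_norm :: "('a::real_inner \<Rightarrow> real) \<Rightarrow> 'a \<Rightarrow> real" where
  "dual_norm N v' = real_of_ereal (support_function (unit_ball N) v')"

lemma
  assumes "admits_dual_norm N"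
  shows is_norm_dual_norm: "is_norm (dual_norm N)"
    and ereal_dual_norm: "ereal (dual_norm N v') = support_function (unit_ball N) v'"
proof -
  from assms obtain M where M: "is_norm M" "\<And>v'. ereal (M v') = support_function (unit_ball N) v'"
    unfolding admits_dual_norm_def by blast
  have "dual_norm N = M"
    by (simp add: dual_norm_def fun_eq_iff M(2)[symmetric])
  with M show "is_norm (dual_norm N)"
    "ereal (dual_norm N v') = support_function (unit_ball N) v'" by simp_all
qed

definition norm_topology :: "('a::real_vector \<Rightarrow> real) \<Rightarrow> 'a topology" where
  "norm_topology N = Metric_space.mtopology UNIV (\<lambda>v w. N (v - w))"

text \<open>The constant \<open>Metric_space.mtopology\<close> is used outside its locale, so the metric axioms
  have to be checked for the distance induced by a norm.\<close>

lemma Metric_space_is_norm: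
  assumes "is_norm N"
  shows "Metric_space UNIV (\<lambda>v w. N (v - w))"
proof
  show "0 \<le> N (v - w)" for v w using assms by (simp add: is_norm_def)
  show "N (v - w) = N (w - v)" for v w
  proof -
    have "N ((- 1) *\<^sub>R (w - v)) = \<bar>- 1\<bar> * N (w - v)" using assms unfolding is_norm_def by blast
    then show ?thesis by simp
  qed
  show "N (v - w) = 0 \<longleftrightarrow> v = w" for v w using assms by (simp add: is_norm_def)
  show "N (v - u) \<le> N (v - w) + N (w - u)" for v w u
  proof -
    have "N ((v - w) + (w - u)) \<le> N (v - w) + N (w - u)" using assms unfolding is_norm_def by blast
    then show ?thesis by simp
  qed
qed

lemma norm_topology_norm: "norm_topology (norm :: 'a::real_normed_vector \<Rightarrow> real) = euclidean"
  unfolding norm_topology_def dist_norm[symmetric] by (rule mtopology_is_euclidean)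

end

theory Submission imports Defs
begin

text \<open>
  Write \<open>U\<close> for the union of the \<open>V j\<close>, \<open>K\<close> for its closed convex hull and \<open>P\<close> for its polar set. Both
  \<open>P\<close> and \<open>K\<close> are closed, convex, symmetric and absorbing: \<open>P\<close> because the \<open>V j\<close> are weakly bounded,
  \<open>K\<close> because of the full sum condition. By the Baire category theorem each of them contains a ball
  centred at the origin; as each is contained in the polar set of the other, each is also bounded.
  Hence the support functions of \<open>P\<close> and \<open>K\<close> are norms dominated by multiples of the Hilbert norm. The unit
  ball of a support function is the polar set of its set, and the polar set of \<open>P\<close> is \<open>K\<close> by the
  bipolar theorem, which follows from the projection theorem.
\<close>

section \<open>Norms and their unit balls\<close>

text \<open>For nonzero \<open>v\<close> the vector \<open>v / M v\<close> lies on the unit sphere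
  of \<open>M\<close>, hence in the unit ball of \<open>N\<close>; homogeneity does the
  rest.\<close>

lemma is_norm_le_if_unit_ball_subset:
  assumes N: "is_norm N" and M: "is_norm M" and sub: "unit_ball M \<subseteq> unit_ball N"
  shows "N v \<le> M v"
proof (cases "v = 0")
  case True
  moreover have "N 0 = 0" "M 0 = 0" using N M unfolding is_norm_def by blast+
  ultimately show ?thesis by simp
next
  case False
  then have pos: "M v > 0" using M unfolding is_norm_def by (metis less_eq_real_def)
  have "M ((1 / M v) *\<^sub>R v) = \<bar>1 / M v\<bar> * M v" using M unfolding is_norm_def by blast
  then have "(1 / M v) *\<^sub>R v \<in> unit_ball M" using pos by (simp add: unit_ball_def)
  then have "N ((1 / M v) *\<^sub>R v) \<le> 1" using sub by (auto simp: unit_ball_def)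
  moreover have "N ((1 / M v) *\<^sub>R v) = \<bar>1 / M v\<bar> * N v" using N unfolding is_norm_def by blast
  ultimately show ?thesis using pos by (simp add: field_simps)
qed

lemma is_norm_eqI:
  assumes "is_norm N" "is_norm M" "unit_ball N = unit_ball M"
  shows "N = M"
proof
  show "N v = M v" for v
    using is_norm_le_if_unit_ball_subset[of N M v] is_norm_le_if_unit_ball_subset[of M N v] assms
    by simp
qed

lemma open_if_openin_norm_topology:
  fixes N :: "'a::real_normed_vector \<Rightarrow> real"
  assumes N: "is_norm N" and le: "\<And>v. N v \<le> C * norm v" and S: "openin (norm_topology N) S"
  shows "open S"
proof -
  interpret Metric_space UNIV "\<lambda>v w. N (v - w)" by (rule Metric_space_is_norm[OF N])
  show ?thesis
    unfolding open_dist
  proof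
    fix x assume "x \<in> S"
    then obtain r where r: "r > 0" "mball x r \<subseteq> S"
      using S unfolding norm_topology_def openin_mtopology by blast
    \<comment> \<open>The sign of \<open>C\<close> is unspecified; \<open>\<bar>C\<bar> + 1\<close>
      dominates it and is a positive divisor.\<close>
    have "y \<in> S" if "dist y x < r / (\<bar>C\<bar> + 1)" for y
    proof -
      have "N (x - y) \<le> C * norm (x - y)" by (rule le)
      also have "\<dots> \<le> (\<bar>C\<bar> + 1) * dist y x"
        by (simp add: dist_norm norm_minus_commute mult_right_mono)
      also have "\<dots> < r" using that by (simp add: field_simps)
      finally show ?thesis using r by (auto simp: subset_iff)
    qed
    moreover have "r / (\<bar>C\<bar> + 1) > 0" using r by simp
    ultimately show "\<exists>e>0. \<forall>y. dist y x < e \<longrightarrow> y \<in> S" by blast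
  qed
qed

section \<open>Support functions of bounded symmetric sets\<close>

lemma support_function_le_iff:
  "support_function A v \<le> ereal t \<longleftrightarrow> (\<forall>a\<in>A. a \<bullet> v \<le> t)"
  by (simp add: support_function_def SUP_le_iff)

text \<open>The setting shared by the two applications, to \<open>P\<close> and to \<open>K\<close>:
  the outer ball makes the support function finite, the inner ball makes it definite, and symmetry
  makes it absolutely homogeneous.\<close>

context
  fixes A :: "'a::real_inner set" and r R :: real
  assumes sym: "uminus ` A = A"
    and r: "r > 0" "cball 0 r \<subseteq> A"
    and R: "A \<subseteq> cball 0 R"
begin

lemma ereal_real_support_function:
  "ereal (real_of_ereal (support_function A v)) = support_function A v"
proof -
  have "0 \<in> A" using r by auto
  then have "ereal (0 \<bullet> v) \<le> support_function A v"
    unfolding support_function_def by (rule SUP_upper)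
  moreover have "a \<bullet> v \<le> R * norm v" if "a \<in> A" for a
    using norm_cauchy_schwarz[of a v] that R mult_right_mono[of "norm a" R "norm v"] by auto
  then have "support_function A v \<le> ereal (R * norm v)" by (simp add: support_function_le_iff)
  ultimately show ?thesis by (intro ereal_real') auto
qed

lemma real_support_function_le_iff:
  "real_of_ereal (support_function A v) \<le> t \<longleftrightarrow> (\<forall>a\<in>A. a \<bullet> v \<le> t)"
  using ereal_real_support_function[of v] support_function_le_iff[of A v t]
  by (metis ereal_less_eq(3))

lemma inner_le_real_support_function:
  "a \<in> A \<Longrightarrow> a \<bullet> v \<le> real_of_ereal (support_function A v)"
  using real_support_function_le_iff by blast

lemma real_support_function_le_norm: "real_of_ereal (support_function A v) \<le> R * norm v"
  unfolding real_support_function_le_iff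
proof
  show "a \<bullet> v \<le> R * norm v" if "a \<in> A" for a
    using norm_cauchy_schwarz[of a v] that R mult_right_mono[of "norm a" R "norm v"] by auto
qed

lemma unit_ball_real_support_function:
  "unit_ball (\<lambda>v. real_of_ereal (support_function A v)) = polar_set A"
  by (auto simp: unit_ball_def polar_set_def real_support_function_le_iff)

lemma is_norm_real_support_function: "is_norm (\<lambda>v. real_of_ereal (support_function A v))"
proof -
  let ?s = "\<lambda>v. real_of_ereal (support_function A v)"
  have zero: "0 \<in> A" using r by auto
  have nonneg: "0 \<le> ?s v" for v using inner_le_real_support_function[OF zero, of v] by simp
  have "?s 0 \<le> 0" unfolding real_support_function_le_iff by simp
  with nonneg[of 0] have s0: "?s 0 = 0" by linarith
  have scale_le: "?s (c *\<^sub>R v) \<le> \<bar>c\<bar> * ?s v" for c v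
    unfolding real_support_function_le_iff
  proof
    fix a assume a: "a \<in> A"
    then have "- a \<in> A" using sym by auto
    with a have "\<bar>a \<bullet> v\<bar> \<le> ?s v"
      using inner_le_real_support_function[of a v] inner_le_real_support_function[of "- a" v] by auto
    then have "\<bar>c\<bar> * \<bar>a \<bullet> v\<bar> \<le> \<bar>c\<bar> * ?s v" by (intro mult_left_mono) auto
    then show "a \<bullet> c *\<^sub>R v \<le> \<bar>c\<bar> * ?s v" by (simp add: abs_mult[symmetric])
  qed
  have scale: "?s (c *\<^sub>R v) = \<bar>c\<bar> * ?s v" for c v
  proof (cases "c = 0")
    case False
    \<comment> \<open>The reverse inequality is \<open>scale_le\<close> for the inverse
      scalar.\<close>
    have "?s ((1 / c) *\<^sub>R (c *\<^sub>R v)) \<le> \<bar>1 / c\<bar> * ?s (c *\<^sub>R v)" by (rule scale_le)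
    with False have "\<bar>c\<bar> * ?s v \<le> ?s (c *\<^sub>R v)" by (simp add: field_simps)
    with scale_le[of c v] show ?thesis by simp
  qed (use s0 in simp)
  have triangle: "?s (v + w) \<le> ?s v + ?s w" for v w
    unfolding real_support_function_le_iff
    using inner_le_real_support_function by (auto simp: inner_add_right intro!: add_mono)
  have definite: "v = 0" if "?s v = 0" for v
  proof (rule ccontr)
    assume "v \<noteq> 0"
    \<comment> \<open>The multiple of \<open>v\<close> of norm \<open>r\<close> lies in the inner
      ball; its inner product with \<open>v\<close> is positive, yet bounded by
      \<open>?s v = 0\<close>.\<close>
    have "(r / norm v) *\<^sub>R v \<in> A" using r \<open>v \<noteq> 0\<close> by (auto intro!: subsetD[OF r(2)])
    from inner_le_real_support_function[OF this, of v] that r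
    have "v \<bullet> v \<le> 0" by (auto simp: divide_le_0_iff mult_le_0_iff)
    with \<open>v \<noteq> 0\<close> inner_gt_zero_iff[of v] show False by linarith
  qed
  show ?thesis
    unfolding is_norm_def using nonneg s0 scale triangle definite by blast
qed

end

section \<open>Projection and bipolar theorem\<close>

text \<open>A sequence minimising the squared distance is Cauchy by convexity, so completeness
  replaces compactness.\<close>

lemma ex_closest_point_closed_convex:
  fixes K :: "'a::{real_inner, complete_space} set"
  assumes "closed K" "convex K" "K \<noteq> {}"
  obtains p where "p \<in> K" "\<And>x. x \<in> K \<Longrightarrow> norm (v - p) \<le> norm (v - x)"
proof -
  define d where "d = (INF x\<in>K. (norm (v - x))\<^sup>2)"
  have bdd: "bdd_below ((\<lambda>x. (norm (v - x))\<^sup>2) ` K)" by (rule bdd_belowI[of _ 0]) auto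
  have d_le: "d \<le> (norm (v - x))\<^sup>2" if "x \<in> K" for x
    unfolding d_def by (rule cINF_lower[OF bdd that])
  have "\<exists>x\<in>K. (norm (v - x))\<^sup>2 < d + 1 / real (Suc n)" for n
    using cINF_less_iff[OF assms(3) bdd, of "d + 1 / real (Suc n)"] by (simp add: d_def)
  then obtain X where X: "\<And>n. X n \<in> K" "\<And>n. (norm (v - X n))\<^sup>2 < d + 1 / real (Suc n)"
    by metis
  \<comment> \<open>The parallelogram identity at the midpoint, which lies in \<open>K\<close>.\<close>
  have near: "(norm (X m - X n))\<^sup>2 < 2 / real (Suc m) + 2 / real (Suc n)" for m n
  proof -
    have "(1/2) *\<^sub>R X m + (1/2) *\<^sub>R X n \<in> K"
      by (rule convexD[OF assms(2)]) (auto simp: X)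
    then have "d \<le> (norm (v - ((1/2) *\<^sub>R X m + (1/2) *\<^sub>R X n)))\<^sup>2" by (rule d_le)
    moreover have "(norm (X m - X n))\<^sup>2 + 4 * (norm (v - ((1/2) *\<^sub>R X m + (1/2) *\<^sub>R X n)))\<^sup>2
        = 2 * (norm (v - X m))\<^sup>2 + 2 * (norm (v - X n))\<^sup>2"
      by (simp add: power2_norm_eq_inner inner_commute algebra_simps)
    ultimately show ?thesis using X(2)[of m] X(2)[of n] by linarith
  qed
  have "Cauchy X"
    unfolding Cauchy_def
  proof (intro allI impI)
    fix e :: real assume "e > 0"
    then obtain M where M: "1 / real (Suc M) < e\<^sup>2 / 4"
      using reals_Archimedean[of "e\<^sup>2 / 4"] by (auto simp: field_simps)
    have "dist (X m) (X n) < e" if "m \<ge> M" "n \<ge> M" for m n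
    proof -
      have "1 / real (Suc m) \<le> 1 / real (Suc M)" "1 / real (Suc n) \<le> 1 / real (Suc M)"
        using that by (simp_all add: frac_le)
      then have "(norm (X m - X n))\<^sup>2 < e\<^sup>2" using near[of m n] M by argo
      then show ?thesis using \<open>e > 0\<close> by (simp add: dist_norm power_less_imp_less_base)
    qed
    then show "\<exists>M. \<forall>m\<ge>M. \<forall>n\<ge>M. dist (X m) (X n) < e" by blast
  qed
  then obtain p where p: "X \<longlonglongrightarrow> p" using Cauchy_convergent convergentD by blast
  have "p \<in> K" using closed_sequentially[OF assms(1) _ p] X(1) by blast
  have lim: "(\<lambda>n. d + 1 / real (Suc n)) \<longlonglongrightarrow> d + 0"
    by (intro tendsto_intros LIMSEQ_Suc[OF lim_1_over_n])
  have "(\<lambda>n. (norm (v - X n))\<^sup>2) \<longlonglongrightarrow> (norm (v - p))\<^sup>2" by (intro tendsto_intros p)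
  from LIMSEQ_le[OF this lim] have "(norm (v - p))\<^sup>2 \<le> d" using X(2) by (auto intro: less_imp_le)
  then have "norm (v - p) \<le> norm (v - x)" if "x \<in> K" for x
    by (rule power2_le_imp_le[OF order_trans[OF _ d_le[OF that]]]) simp_all
  with \<open>p \<in> K\<close> show ?thesis by (rule that)
qed

text \<open>With \<open>p\<close> the point of \<open>K\<close> closest to \<open>v\<close>, the
  hyperplane through \<open>p\<close> with normal \<open>v - p\<close> separates.\<close>

lemma separating_hyperplane_closed_convex:
  fixes K :: "'a::{real_inner, complete_space} set"
  assumes K: "closed K" "convex K" "K \<noteq> {}" and v: "v \<notin> K"
  obtains a b where "\<And>x. x \<in> K \<Longrightarrow> x \<bullet> a \<le> b" "b < v \<bullet> a"
proof -
  obtain p where p: "p \<in> K" "\<And>x. x \<in> K \<Longrightarrow> norm (v - p) \<le> norm (v - x)"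
    using ex_closest_point_closed_convex[OF K, of v] by blast
  show ?thesis
  proof
    show "x \<bullet> (v - p) \<le> p \<bullet> (v - p)" if "x \<in> K" for x
    proof (rule ccontr)
      assume "\<not> ?thesis"
      then have "(v - p) \<bullet> (x - p) > 0" by (simp add: inner_diff_left inner_diff_right inner_commute)
      \<comment> \<open>If \<open>x - p\<close> makes an acute angle with \<open>v - p\<close>, a
        small step from \<open>p\<close> towards \<open>x\<close> comes closer to \<open>v\<close>;
        by convexity it stays in \<open>K\<close>, against the choice of \<open>p\<close>.\<close>
      from closer_point_lemma[OF this] obtain u
        where u: "u > 0" "u \<le> 1" "dist (p + u *\<^sub>R (x - p)) v < dist p v"
        by (metis dist_commute)
      have "(1 - u) *\<^sub>R p + u *\<^sub>R x \<in> K"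
        by (rule convexD[OF K(2)]) (use u p that in auto)
      also have "(1 - u) *\<^sub>R p + u *\<^sub>R x = p + u *\<^sub>R (x - p)" by (simp add: algebra_simps)
      finally show False using p(2) u(3) by (force simp: dist_norm norm_minus_commute)
    qed
    have "v - p \<noteq> 0" using v p(1) by auto
    then have "(v - p) \<bullet> (v - p) > 0" by simp
    then show "p \<bullet> (v - p) < v \<bullet> (v - p)" by (simp only: inner_diff_left)
  qed
qed

text \<open>The half-spaces that define the polar set are closed and convex, so each contains the
  hull as soon as it contains \<open>U\<close>.\<close>

lemma polar_set_closed_convex_hull:
  fixes U :: "'a::real_inner set"
  shows "polar_set (closed_convex_hull U) = polar_set U"
proof -
  have "closed_convex_hull U \<subseteq> {x. x \<bullet> v \<le> 1} \<longleftrightarrow> U \<subseteq> {x. x \<bullet> v \<le> 1}" for v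
  proof
    have "closed {x. x \<bullet> v \<le> 1}" "convex {x. x \<bullet> v \<le> 1}"
      using closed_halfspace_le[of v 1] convex_halfspace_le[of v 1] by (simp_all add: inner_commute)
    then show "closed_convex_hull U \<subseteq> {x. x \<bullet> v \<le> 1}" if "U \<subseteq> {x. x \<bullet> v \<le> 1}"
      unfolding closed_convex_hull_eq_hull using that by (intro hull_minimal) auto
    show "U \<subseteq> {x. x \<bullet> v \<le> 1}" if "closed_convex_hull U \<subseteq> {x. x \<bullet> v \<le> 1}"
      using that hull_subset[of U] unfolding closed_convex_hull_eq_hull by (rule order_trans[rotated])
  qed
  then show ?thesis unfolding polar_set_def by blast
qed

text \<open>A point outside the hull is cut off by a hyperplane whose suitably rescaled normal lies
  in the polar set. A bipolar always contains the origin, which explains the hypothesis.\<close>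

lemma bipolar:
  fixes U :: "'a::{real_inner, complete_space} set"
  assumes "0 \<in> closed_convex_hull U"
  shows "polar_set (polar_set U) = closed_convex_hull U"
proof
  let ?K = "closed_convex_hull U"
  have K: "closed ?K" "convex ?K" by (simp_all add: closed_convex_hull_def convex_closure)
  show "polar_set (polar_set U) \<subseteq> ?K"
  proof (rule ccontr)
    assume "\<not> ?thesis"
    then obtain v where v: "v \<in> polar_set (polar_set U)" "v \<notin> ?K" by blast
    obtain a b where ab: "\<And>x. x \<in> ?K \<Longrightarrow> x \<bullet> a \<le> b" "b < v \<bullet> a"
      using separating_hyperplane_closed_convex[OF K _ v(2)] assms by blast
    \<comment> \<open>The bound \<open>b\<close> may be 0; the midpoint still separates and is
      positive, so \<open>a\<close> can be divided by it.\<close>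
    define c where "c = (b + v \<bullet> a) / 2"
    have "0 \<le> b" using ab(1)[OF assms] by simp
    then have c: "0 < c" "b < c" "c < v \<bullet> a" using ab(2) by (auto simp: c_def)
    have "(1 / c) *\<^sub>R a \<in> polar_set ?K"
      using ab(1) c by (fastforce simp: polar_set_def)
    then have "((1 / c) *\<^sub>R a) \<bullet> v \<le> 1"
      using v(1) unfolding polar_set_closed_convex_hull polar_set_def[of "polar_set U"] by blast
    then show False using c by (simp add: inner_commute field_simps)
  qed
  show "?K \<subseteq> polar_set (polar_set U)"
    unfolding polar_set_closed_convex_hull[of U, symmetric]
    by (auto simp: polar_set_def inner_commute)
qed

section \<open>Absorbing sets\<close>

text \<open>The integer multiples of \<open>K\<close> cover the space, so by Baire one of them has
  an interior point; symmetry and convexity move the ball around it to the origin.\<close>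

lemma closed_convex_absorbing_contains_cball:
  fixes K :: "'a::{real_normed_vector, complete_space} set"
  assumes K: "closed K" "convex K" "uminus ` K = K"
    and absorbing: "\<And>v. \<exists>t>0. (1 / t) *\<^sub>R v \<in> K"
  obtains r where "r > 0" "cball 0 r \<subseteq> K"
proof -
  have zero: "0 \<in> K" using absorbing[of 0] by auto
  have "\<exists>n. v \<in> (*\<^sub>R) (real (Suc n)) ` K" for v
  proof -
    obtain t where t: "t > 0" "(1 / t) *\<^sub>R v \<in> K" using absorbing by blast
    obtain n where n: "t \<le> real (Suc n)"
      using real_arch_simple[of t] by (metis le_SucI of_nat_le_iff order_refl order_trans)
    then have le1: "t / real (Suc n) \<le> 1" by simp
    \<comment> \<open>Since \<open>K\<close> is star-shaped about 0, the factor \<open>t\<close> may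
      be enlarged to the integer \<open>Suc n\<close>.\<close>
    have "(t / real (Suc n)) *\<^sub>R ((1 / t) *\<^sub>R v) + (1 - t / real (Suc n)) *\<^sub>R 0 \<in> K"
      by (rule convexD[OF K(2)]) (use t zero le1 in auto)
    then have "(1 / real (Suc n)) *\<^sub>R v \<in> K" using t by simp
    then have "real (Suc n) *\<^sub>R ((1 / real (Suc n)) *\<^sub>R v) \<in> (*\<^sub>R) (real (Suc n)) ` K"
      by (rule imageI)
    then show ?thesis by (intro exI[of _ n]) simp
  qed
  then have UN: "\<Union>(range (\<lambda>n. (*\<^sub>R) (real (Suc n)) ` K)) = UNIV" by blast
  obtain n where n: "interior ((*\<^sub>R) (real (Suc n)) ` K) \<noteq> {}"
  proof (rule ccontr)
    assume "\<not> thesis"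
    then have "euclidean interior_of \<Union>(range (\<lambda>n. (*\<^sub>R) (real (Suc n)) ` K)) = {}"
      using that
      by (intro Baire_category_alt)
        (auto simp: completely_metrizable_space_euclidean closed_scaling K)
    then show False unfolding UN by simp
  qed
  then obtain x e where e: "e > 0" "ball x e \<subseteq> (*\<^sub>R) (real (Suc n)) ` K"
    by (meson all_not_in_conv mem_interior)
  \<comment> \<open>\<open>y\<close> is the average of \<open>x + y\<close> and
    \<open>- (x - y)\<close>, where \<open>x + y\<close> and \<open>x - y\<close> both lie in the
    ball around \<open>x\<close>.\<close>
  have half: "(1 / real (Suc n)) *\<^sub>R y \<in> K" if "y \<in> ball 0 e" for y
  proof -
    have in_K: "(1 / real (Suc n)) *\<^sub>R z \<in> K" if "z \<in> ball x e" for z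
      using that e(2) by (auto dest!: subsetD)
    have "- ((1 / real (Suc n)) *\<^sub>R (x - y)) \<in> K"
      using K(3) in_K[of "x - y"] that by (auto simp: dist_norm)
    moreover have "(1 / real (Suc n)) *\<^sub>R (x + y) \<in> K"
      using in_K[of "x + y"] that by (auto simp: dist_norm)
    ultimately have "(1/2) *\<^sub>R (- ((1 / real (Suc n)) *\<^sub>R (x - y)))
        + (1/2) *\<^sub>R ((1 / real (Suc n)) *\<^sub>R (x + y)) \<in> K"
      by (intro convexD[OF K(2)]) auto
    also have "(1/2) *\<^sub>R (- ((1 / real (Suc n)) *\<^sub>R (x - y)))
        + (1/2) *\<^sub>R ((1 / real (Suc n)) *\<^sub>R (x + y))
      = (1/2 + 1/2) *\<^sub>R ((1 / real (Suc n)) *\<^sub>R y)"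
      unfolding scaleR_add_left by (simp add: algebra_simps)
    finally show ?thesis by simp
  qed
  show ?thesis
  proof
    \<comment> \<open>The factor 2 lets the closed ball, after scaling by \<open>Suc n\<close>, fit
      into the open ball of radius \<open>e\<close>.\<close>
    show "e / (2 * real (Suc n)) > 0" using e by simp
    show "cball 0 (e / (2 * real (Suc n))) \<subseteq> K"
    proof
      fix y :: 'a assume "y \<in> cball 0 (e / (2 * real (Suc n)))"
      then have "real (Suc n) * norm y \<le> e / 2" by (simp add: field_simps)
      also have "\<dots> < e" using e by simp
      finally have "real (Suc n) *\<^sub>R y \<in> ball 0 e" by simp
      from half[OF this] show "y \<in> K" by simp
    qed
  qed
qed

text \<open>Turns a spanning condition into absorption, by building \<open>v\<close> up one summand
  at a time.\<close>

lemma convex_symmetric_absorbs_span: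
  fixes C :: "'a::real_vector set"
  assumes C: "convex C" "uminus ` C = C" "C \<noteq> {}" and v: "v \<in> span C"
  shows "\<exists>t>0. (1 / t) *\<^sub>R v \<in> C"
proof -
  obtain x where x: "x \<in> C" "- x \<in> C" using C(2,3) by blast
  have "(1/2) *\<^sub>R x + (1/2) *\<^sub>R (- x) \<in> C" by (rule convexD[OF C(1)]) (auto simp: x)
  then have zero: "0 \<in> C" by simp
  show ?thesis
    using v
  proof (induction rule: span_induct_alt)
    case base
    show ?case using zero by (auto intro!: exI[of _ 1])
  next
    case (step c x y)
    then obtain t where t: "t > 0" "(1 / t) *\<^sub>R y \<in> C" by blast
    show ?case
    proof (cases "c = 0")
      case True
      then show ?thesis using t by auto
    next
      case False
      have "sgn c *\<^sub>R x \<in> C" using C(2) step(1) False by (auto simp: sgn_real_def)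
      \<comment> \<open>The absorption factors \<open>\<bar>c\<bar>\<close> of
        \<open>c *\<^sub>R x\<close> and \<open>t\<close> of \<open>y\<close> add up; they also
        serve as the convex weights.\<close>
      then have "(\<bar>c\<bar> / (\<bar>c\<bar> + t)) *\<^sub>R (sgn c *\<^sub>R x) + (t / (\<bar>c\<bar> + t)) *\<^sub>R ((1 / t) *\<^sub>R y) \<in> C"
        using t by (intro convexD[OF C(1)]) (auto simp: add_divide_distrib[symmetric])
      also have "(\<bar>c\<bar> / (\<bar>c\<bar> + t)) *\<^sub>R (sgn c *\<^sub>R x) + (t / (\<bar>c\<bar> + t)) *\<^sub>R ((1 / t) *\<^sub>R y)
          = (1 / (\<bar>c\<bar> + t)) *\<^sub>R (c *\<^sub>R x + y)"
        using t by (simp add: scaleR_add_right abs_mult_sgn)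
      finally show ?thesis using t by (intro exI[of _ "\<bar>c\<bar> + t"]) auto
    qed
  qed
qed

lemma sum_sets_subset_subspace:
  assumes "subspace S" "\<And>j. j \<in> J \<Longrightarrow> A j \<subseteq> S"
  shows "sum A J \<subseteq> S"
  using assms(2)
proof (induction J rule: infinite_finite_induct)
  case (insert j J)
  then have "A j \<subseteq> S" "sum A J \<subseteq> S" by auto
  then show ?case
    using insert(1,2) subspace_add[OF assms(1)] by (auto elim!: set_plus_elim)
\<comment> \<open>The Minkowski sum over an empty or infinite index set is
  \<open>{0}\<close>.\<close>
qed (use subspace_0[OF assms(1)] in auto)

text \<open>The support function of a union of two sets is the maximum of their support functions,
  finite above exactly when both are.\<close>

lemma barrier_cone_UN_finite:
  fixes V :: "'j \<Rightarrow> 'a::real_inner set"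
  assumes "finite J"
  shows "barrier_cone (\<Union>j\<in>J. V j) = (\<Inter>j\<in>J. barrier_cone (V j))"
  using assms
proof (induction J)
  case (insert j J)
  have "barrier_cone (A \<union> B) = barrier_cone A \<inter> barrier_cone B" for A B :: "'a set"
    by (auto simp: barrier_cone_def support_function_def SUP_union max_def split: if_splits)
  then show ?case using insert by simp
\<comment> \<open>For the empty family the support function is constantly minus infinity, so both
  sides are the whole space.\<close>
qed (simp add: barrier_cone_def support_function_def bot_ereal_def)

lemma barrier_coneE:
  assumes "v \<in> barrier_cone U"
  obtains t where "t > 0" "\<And>u. u \<in> U \<Longrightarrow> u \<bullet> v \<le> t"
proof -
  obtain q where "support_function U v \<le> ereal q"
    using assms less_PInf_Ex_of_nat[of "support_function U v"]
    by (auto simp: barrier_cone_def intro: less_imp_le)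
  then have "\<And>u. u \<in> U \<Longrightarrow> u \<bullet> v \<le> max q 1" by (force simp: support_function_le_iff)
  then show ?thesis by (intro that[of "max q 1"]) auto
qed

text \<open>Testing \<open>v\<close> against its multiple of norm \<open>r\<close>, which lies in
  \<open>A\<close>, gives \<open>r * norm v \<le> 1\<close>.\<close>

lemma polar_set_subset_cball:
  assumes r: "r > 0" "cball 0 r \<subseteq> A"
  shows "polar_set A \<subseteq> cball 0 (1 / r)"
proof
  fix v assume v: "v \<in> polar_set A"
  show "v \<in> cball 0 (1 / r)"
  proof (cases "v = 0")
    case False
    have "(r / norm v) *\<^sub>R v \<in> A" using r False by (auto intro!: subsetD[OF r(2)])
    then have "((r / norm v) *\<^sub>R v) \<bullet> v \<le> 1" using v by (auto simp: polar_set_def)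
    moreover have "((r / norm v) *\<^sub>R v) \<bullet> v = r * norm v"
      using False by (simp add: power2_norm_eq_inner[symmetric] power2_eq_square)
    ultimately show ?thesis using r by (simp add: field_simps)
  qed (use r in simp)
qed

lemma uminus_image_polar_set:
  assumes "uminus ` U = U"
  shows "uminus ` polar_set U = polar_set U"
proof -
  have *: "- v \<in> polar_set U" if "v \<in> polar_set U" for v
    unfolding polar_set_def
  proof (intro CollectI ballI)
    fix u assume "u \<in> U"
    then have "- u \<in> U" using assms by auto
    then have "(- u) \<bullet> v \<le> 1" using that by (auto simp: polar_set_def)
    then show "u \<bullet> - v \<le> 1" by simp
  qed
  show ?thesis using * by (force simp: image_iff)
qed

section \<open>The norm with the closed convex hull as unit ball, and its dual\<close>

theorem proposition14:
  fixes J :: "'j set"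
    and V :: "'j \<Rightarrow> 'a::{real_inner, complete_space} set"
  assumes "finite J"
    and "\<exists>j\<in>J. V j \<noteq> {}"
    and "\<And>j. j \<in> J \<Longrightarrow> uminus ` V j = V j"
    and "\<And>j. j \<in> J \<Longrightarrow> barrier_cone (V j) = UNIV"
    and "(\<Sum>j\<in>J. span (V j)) = UNIV"
  shows "(\<exists>!N. is_norm N \<and> unit_ball N = closed_convex_hull (\<Union>j\<in>J. V j)) \<and>
    (\<forall>N. is_norm N \<and> unit_ball N = closed_convex_hull (\<Union>j\<in>J. V j) \<longrightarrow>
       admits_dual_norm N \<and>
       unit_ball (dual_norm N) = polar_set (\<Union>j\<in>J. V j) \<and>
       (\<forall>v. ereal (N v) = support_function (polar_set (\<Union>j\<in>J. V j)) v) \<and>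
       (\<forall>v. ereal (dual_norm N v) = support_function (closed_convex_hull (\<Union>j\<in>J. V j)) v) \<and>
       (\<forall>S. openin (norm_topology N) S \<longrightarrow> open S) \<and>
       (\<forall>S. openin (norm_topology (dual_norm N)) S \<longrightarrow> open S))"
proof -
  define U where "U = (\<Union>j\<in>J. V j)"
  define K where "K = closed_convex_hull U"
  define P where "P = polar_set U"
  have "U \<noteq> {}" using assms(2) by (auto simp: U_def)
  have symU: "uminus ` U = U" unfolding U_def image_UN using assms(3) by simp
  have symC: "uminus ` (convex hull U) = convex hull U"
    using convex_hull_linear_image[OF linear_uminus, of U] by (simp add: symU)
  have symK: "uminus ` K = K"
    using closure_scaleR[of "- 1" "convex hull U"] symC
    by (simp add: K_def closed_convex_hull_def)
  have symP: "uminus ` P = P" unfolding P_def by (rule uminus_image_polar_set[OF symU])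
  have polarK: "polar_set K = P" by (simp add: K_def P_def polar_set_closed_convex_hull)
  have UK: "convex hull U \<subseteq> K" by (simp add: K_def closed_convex_hull_def closure_subset)
  have closedK: "closed K" "convex K" by (simp_all add: K_def closed_convex_hull_def convex_closure)

  \<comment> \<open>The full sum condition enters here: it makes \<open>K\<close> absorbing.\<close>
  have "(\<Sum>j\<in>J. span (V j)) \<subseteq> span (convex hull U)"
    by (intro sum_sets_subset_subspace subspace_span span_mono order_trans[OF _ hull_subset])
      (auto simp: U_def)
  then have "v \<in> span (convex hull U)" for v using assms(5) by auto
  then have "\<exists>t>0. (1 / t) *\<^sub>R v \<in> K" for v
    using convex_symmetric_absorbs_span[OF convex_convex_hull symC, of v] \<open>U \<noteq> {}\<close> UK by auto
  from closed_convex_absorbing_contains_cball[OF closedK symK this]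
  obtain r where r: "r > 0" "cball 0 r \<subseteq> K" by blast

  have P_eq: "P = (\<Inter>u\<in>U. {v. u \<bullet> v \<le> 1})" by (auto simp: P_def polar_set_def)
  have closedP: "closed P" "convex P"
    unfolding P_eq by (auto intro!: closed_INT convex_INT closed_halfspace_le convex_halfspace_le)
  \<comment> \<open>Weak boundedness passes to \<open>U\<close> because \<open>J\<close> is finite;
    a bound \<open>t\<close> for \<open>U\<close> in direction \<open>v\<close> puts
    \<open>v / t\<close> into \<open>P\<close>.\<close>
  have "barrier_cone U = UNIV"
    unfolding U_def barrier_cone_UN_finite[OF assms(1)] using assms(4) by auto
  have "\<exists>t>0. (1 / t) *\<^sub>R v \<in> P" for v
  proof -
    obtain t where t: "t > 0" "\<And>u. u \<in> U \<Longrightarrow> u \<bullet> v \<le> t"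
      using barrier_coneE[of v U] \<open>barrier_cone U = UNIV\<close> by auto
    then have "(1 / t) *\<^sub>R v \<in> P" by (auto simp: P_def polar_set_def field_simps)
    with t show ?thesis by blast
  qed
  from closed_convex_absorbing_contains_cball[OF closedP symP this]
  obtain q where q: "q > 0" "cball 0 q \<subseteq> P" by blast

  have polarP: "polar_set P = K"
    unfolding P_def K_def by (rule bipolar) (use r in \<open>auto simp: K_def\<close>)
  \<comment> \<open>The bounds cross over: the ball inside \<open>K\<close> bounds \<open>P\<close>,
    and the ball inside \<open>P\<close> bounds \<open>K\<close>.\<close>
  have P_bounded: "P \<subseteq> cball 0 (1 / r)" using polar_set_subset_cball[OF r] polarK by simp
  have K_bounded: "K \<subseteq> cball 0 (1 / q)" using polar_set_subset_cball[OF q] polarP by simp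
  define N where "N = (\<lambda>v. real_of_ereal (support_function P v))"
  define M where "M = (\<lambda>v. real_of_ereal (support_function K v))"
  note P = symP q P_bounded
  note K = symK r K_bounded
  have N: "is_norm N" "unit_ball N = K" "\<And>v. ereal (N v) = support_function P v"
      "\<And>v. N v \<le> 1 / r * norm v"
    unfolding N_def polarP[symmetric]
    by (fact is_norm_real_support_function[OF P] unit_ball_real_support_function[OF P]
        ereal_real_support_function[OF P] real_support_function_le_norm[OF P])+
  have M: "is_norm M" "unit_ball M = P" "\<And>v. ereal (M v) = support_function K v"
      "\<And>v. M v \<le> 1 / q * norm v"
    unfolding M_def polarK[symmetric]
    by (fact is_norm_real_support_function[OF K] unit_ball_real_support_function[OF K]
        ereal_real_support_function[OF K] real_support_function_le_norm[OF K])+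
  \<comment> \<open>The unit ball of \<open>N\<close> is \<open>K\<close>, so both sides are the
    support function of \<open>K\<close>.\<close>
  have dual: "dual_norm N = M" by (simp add: dual_norm_def M_def N(2) fun_eq_iff)
  have admits: "admits_dual_norm N"
    unfolding admits_dual_norm_def N(2) using M(1,3) by blast
  have unique: "L = N" if "is_norm L \<and> unit_ball L = K" for L
    using that N(1,2) by (intro is_norm_eqI) auto
  show ?thesis
    unfolding U_def[symmetric] K_def[symmetric] P_def[symmetric]
  proof (intro conjI allI impI)
    show "\<exists>!N. is_norm N \<and> unit_ball N = K"
      using N(1,2) unique by blast
  next
    fix L assume "is_norm L \<and> unit_ball L = K"
    then have L: "L = N" by (rule unique)
    show "admits_dual_norm L" "unit_ball (dual_norm L) = P"
      by (simp_all add: L dual M(2) admits)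
    show "ereal (L v) = support_function P v" "ereal (dual_norm L v) = support_function K v" for v
      by (simp_all add: L dual M(3) N(3))
    show "open S" if "openin (norm_topology L) S" for S
      using open_if_openin_norm_topology[OF N(1,4)] that by (simp add: L)
    show "open S" if "openin (norm_topology (dual_norm L)) S" for S
      using open_if_openin_norm_topology[OF M(1,4)] that by (simp add: L dual)
  qed
qed

end
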